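(* The Ehrhart polynomial of the hypersimplex $\Delta_{k,n}$ can be expressed as $$\mathcal{E}(\Delta_{k,n})=\frac{1}{(n+1)!}\sum_{P}\ \sum_{\sigma\in S_{n+1}} t^{\,TrBl_P(\sigma)},$$ where the first sum ranges over all fence posets $P$ of size $n+1$ with exactly $k$ descents.
   Context: $\Delta_{k,n}=\{x\in[0,1]^n : x_1+\dots+x_n=k\}$, with $0\le k\le n$ integers, and $\mathcal{E}(\Delta_{k,n})$ is its Ehrhart polynomial in the variable $t$: for each positive integer $t$ it counts the lattice points in the $t$-th dilate $t\Delta_{k,n}$. A fence poset of size $n+1$ is a poset on elements $z_0,\dots,z_n$ arranged from left to right whose Hasse diagram is a path joining consecutive elements, the order being generated by one relation ($z_{i-1}\prec z_i$ or $z_{i-1}\succ z_i$) for each $1\le i\le n$; fence posets are counted as such left-to-right sequences of relations (not up to isomorphism). $\mathrm{desc}(P)$ is the set of elements lower than the element immediately at their left (the descents, or descent elements); $\mathrm{asc}(P)$ is the set of elements greater than the element immediately at their left, together with the leftmost element (ascent elements). Block statistic. Let $Q$ be a fence poset and $\sigma$ an injective integer labeling of $Q$. A block is a nonempty set of consecutive elements such that, writing $x$ for its leftmost element (its root), every other element $y$ of the block satisfies $\sigma(y)<\sigma(x)$ if $y\in\mathrm{asc}(Q)$ and $\sigma(y)>\sigma(x)$ if $y\in\mathrm{desc}(Q)$. A partition of $Q$ into blocks $B_1,\dots,B_m$ with roots $x_1,\dots,x_m$ is valid if for all $i\ne j$, whenever some $y\in B_i$, $z\in B_j$ satisfy $y<_Q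 z$, one has $\sigma(x_i)<\sigma(x_j)$. There is exactly one valid block partition, and $bl_Q(\sigma)$ is its number of blocks ($bl_\emptyset=0$). Truncation. For a fence poset $P$, the truncated poset $Tr(P)$ is the fence poset obtained from $P$ by removing the leftmost element of $P$, all descent elements on the leftmost branch of $P$, and all ascent elements on the rightmost branch of $P$. Here the descent elements on the leftmost branch are the elements after the leftmost one in the maximal descending run starting at the leftmost element (none if the first relation is an ascent), and the ascent elements on the rightmost branch are the elements, other than the bottom one, of the maximal ascending run ending at the rightmost element (none if the last relation is a descent). $Tr(P)$ may be empty. For a labeling $\sigma$ of $P$ by a bijection $P\to\{1,\dots,n+1\}$ (identified with an element of $S_{n+1}$), the truncated block statistic is $TrBl_P(\sigma):=bl_{Tr(P)}(\sigma|_{Tr(P)})$.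
   Formalization: Tr(P) here also removes the bottom element of the rightmost ascending run (the rightmost element itself if the last relation is a descent); with it kept, the formula fails, e.g. n=2, k=1 gives 1+t/2+t²/2 instead of 1+t. The degenerate case n=0 is not covered. *)

theory Defs
  imports
    "HOL-Analysis.Analysis"
    "HOL-Computational_Algebra.Polynomial"
    "HOL-Library.Disjoint_Sets"
    "HOL-Library.FuncSet"
begin

section \<open>Hypersimplices and Ehrhart polynomials\<close>

definition hypersimplex :: "nat \<Rightarrow> (real ^ 'n) set" where
  "hypersimplex k = {x. (\<forall>i. 0 \<le> x $ i \<and> x $ i \<le> 1) \<and> (\<Sum>i\<in>UNIV. x $ i) = real k}"

definition lattice_points :: "(real ^ 'n) set \<Rightarrow> (real ^ 'n) set" where
  "lattice_points S = {x \<in> S. \<forall>i. x $ i \<in> \<int>}"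

text \<open>Intended for bounded \<open>S\<close>, where the set being counted is finite.\<close>

definition is_ehrhart_polynomial :: "(real ^ 'n) set \<Rightarrow> real poly \<Rightarrow> bool" where
  "is_ehrhart_polynomial S p \<longleftrightarrow>
     (\<forall>t::nat. t > 0 \<longrightarrow> poly p (real t) = real (card (lattice_points ((\<lambda>x. real t *\<^sub>R x) ` S))))"

lemma is_ehrhart_polynomial_unique:
  assumes "is_ehrhart_polynomial S p" and "is_ehrhart_polynomial S q"
  shows "p = q"
proof (rule ccontr)
  assume "p \<noteq> q"
  then have "finite {x. poly (p - q) x = 0}"
    by (intro poly_roots_finite) simp
  moreover have "real ` {0<..} \<subseteq> {x. poly (p - q) x = 0}"
    using assms by (auto simp: is_ehrhart_polynomial_def)
  ultimately have "finite (real ` {0<..})"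
    by (rule finite_subset[rotated])
  then have "finite {0::nat<..}"
    by (rule finite_imageD) (auto simp: inj_on_def)
  then show False
    using infinite_Ioi by blast
qed


section \<open>Fence posets\<close>

text \<open>The element \<open>z\<^sub>i\<close> is represented by its index \<open>i\<close>. A fence poset is given by an interval of
  indices together with the set of its descents; \<open>i \<in> desc P\<close> encodes the relation
  \<open>z\<^sub>i \<prec> z\<^sub>i\<^sub>-\<^sub>1\<close>. Intervals that do not start at \<open>0\<close>, and the empty one, arise from truncation.\<close>

record fence =
  elts :: "nat set"
  desc :: "nat set"

definition fence_posets :: "nat \<Rightarrow> fence set" where
  "fence_posets m = {P. elts P = {0..<m} \<and> desc P \<subseteq> {1..<m}}"

text \<open>The leftmost element is never in \<open>desc P\<close>, so it belongs to \<open>asc P\<close>.\<close>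

definition asc :: "fence \<Rightarrow> nat set" where
  "asc P = elts P - desc P"

definition fence_less :: "fence \<Rightarrow> nat rel" where
  "fence_less P =
     ({(i, Suc i) | i. i \<in> elts P \<and> Suc i \<in> elts P \<and> Suc i \<in> asc P} \<union>
      {(Suc i, i) | i. i \<in> elts P \<and> Suc i \<in> elts P \<and> Suc i \<in> desc P})\<^sup>+"


section \<open>The block statistic\<close>

definition is_block :: "fence \<Rightarrow> (nat \<Rightarrow> int) \<Rightarrow> nat set \<Rightarrow> bool" where
  "is_block Q \<sigma> B \<longleftrightarrow>
     B \<subseteq> elts Q \<and> (\<exists>a b. a \<le> b \<and> B = {a..b}) \<and>
     (\<forall>y\<in>B - {Min B}.
        (y \<in> asc Q \<longrightarrow> \<sigma> y < \<sigma> (Min B)) \<and> (y \<in> desc Q \<longrightarrow> \<sigma> y > \<sigma> (Min B)))"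

definition valid_block_partition :: "fence \<Rightarrow> (nat \<Rightarrow> int) \<Rightarrow> nat set set \<Rightarrow> bool" where
  "valid_block_partition Q \<sigma> \<B> \<longleftrightarrow>
     partition_on (elts Q) \<B> \<and> (\<forall>B\<in>\<B>. is_block Q \<sigma> B) \<and>
     (\<forall>B\<in>\<B>. \<forall>C\<in>\<B>. B \<noteq> C \<longrightarrow> (\<exists>y\<in>B. \<exists>z\<in>C. (y, z) \<in> fence_less Q) \<longrightarrow>
        \<sigma> (Min B) < \<sigma> (Min C))"

definition bl :: "fence \<Rightarrow> (nat \<Rightarrow> int) \<Rightarrow> nat" where
  "bl Q \<sigma> = card (THE \<B>. valid_block_partition Q \<sigma> \<B>)"


section \<open>Truncation\<close>

text \<open>The leftmost element together with the descents following it.\<close>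

definition left_branch :: "fence \<Rightarrow> nat set" where
  "left_branch P = {i \<in> elts P. \<forall>j\<in>elts P. j \<le> i \<longrightarrow> j = Min (elts P) \<or> j \<in> desc P}"

text \<open>The maximal ascending run ending at the rightmost element, including its bottom element;
  if the last relation is a descent, the run is just the rightmost element.

  The bottom has to be included. If one removes from the run only the ascents, i.e. only the
  elements \<open>i\<close> with \<open>j \<in> asc P\<close> for all \<open>j \<ge> i\<close>, the Ehrhart formula fails for \<open>0 < k < n\<close>:
  the fences that begin with an ascent and end with a descent then keep \<open>n\<close> elements and contribute
  terms of degree \<open>n\<close>, whereas the hypersimplex has dimension \<open>n - 1\<close>. For \<open>n = 2\<close>, \<open>k = 1\<close> the sum
  would be \<open>1 + t/2 + t\<^sup>2/2\<close> instead of \<open>1 + t\<close>.\<close>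

definition right_branch :: "fence \<Rightarrow> nat set" where
  "right_branch P = {i \<in> elts P. \<forall>j\<in>elts P. i < j \<longrightarrow> j \<in> asc P}"

text \<open>If anything remains, its leftmost element is an ascent of \<open>P\<close>, so the remaining descents
  of \<open>P\<close> are exactly the descents of the truncated fence.\<close>

definition truncation :: "fence \<Rightarrow> fence" where
  "truncation P =
     (let A = elts P - left_branch P - right_branch P in \<lparr>elts = A, desc = desc P \<inter> A\<rparr>)"

definition labelings :: "fence \<Rightarrow> (nat \<Rightarrow> int) set" where
  "labelings P =
     {\<sigma> \<in> elts P \<rightarrow>\<^sub>E {1..int (card (elts P))}. bij_betw \<sigma> (elts P) {1..int (card (elts P))}}"

definition TrBl :: "fence \<Rightarrow> (nat \<Rightarrow> int) \<Rightarrow> nat" where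
  "TrBl P \<sigma> = bl (truncation P) (restrict \<sigma> (elts (truncation P)))"

end

theory Submission
  imports Defs
begin

text \<open>
  The sum over labelings and the count of lattice points meet in the middle, in the numbers
  \<open>\<Omega> (Tr P) t\<close> of order-preserving maps from the truncated fences to a chain with \<open>t\<close> elements.

  Lattice points. Let \<open>x\<close> be a lattice point of the dilated hypersimplex: \<open>n\<close> integers between \<open>0\<close> and
  \<open>t\<close> with sum \<open>k t\<close>. Take the partial sums \<open>s\<^sub>0, \<dots>, s\<^sub>n\<close> and their residues \<open>r\<^sub>i\<close> modulo
  \<open>t\<close>, and call \<open>i\<close> a descent if \<open>s\<^sub>i\<close> passes the next multiple of \<open>t\<close> (reaching it included). There are
  \<open>k\<close> descents, and since \<open>0 \<le> x\<^sub>i \<le> t\<close>, the \<open>r\<^sub>i\<close> fall weakly at descents and rise weakly elsewhere. So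
  \<open>r\<close> is an order-preserving map on the fence with these descents, with \<open>r\<^sub>0 = r\<^sub>n = 0\<close>, and
  \<open>x\<close> can be recovered from it (\<open>sum_closed_walks\<close>). As \<open>0\<close> is the least value, the two boundary
  conditions force \<open>r\<close> to vanish on exactly the two branches that truncation removes, and they do not
  constrain it elsewhere (\<open>closed_walks_eq_order_maps\<close>). Hence the number of lattice points is the sum
  of \<open>\<Omega> (Tr P) t\<close> over the fences with \<open>k\<close> descents.

  Labelings. For a fence \<open>Q\<close> with \<open>m\<close> elements, the sum of \<open>t\<close> to the power \<open>bl\<^sub>Q \<sigma>\<close> over its
  labelings is \<open>m!\<close> times \<open>\<Omega> Q t\<close> (\<open>sum_power_roots\<close>). The blocks are found by reading the labels from left
  to right (\<open>bl_eq_roots\<close>): an ascent opens a new block if its label exceeds that of the current root, and a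
  descent if its label is smaller. Reversing the relation at one element \<open>y\<close> therefore exchanges
  \<open>y opens a block\<close> and \<open>y joins a block\<close>. Adding both cases, one obtains for every labeling the product of
  the terms for the fence cut before \<open>y\<close>, plus the term for the fence with \<open>y\<close> deleted
  (\<open>power_roots_toggle\<close>). The order polynomial satisfies the same relation (\<open>order_maps_toggle\<close>), so
  everything reduces to chains, where blocks are counted by left-to-right maxima.

  Finally, the block statistic of the truncated fence depends only on the relative order of the labels
  there, so passing from its own labelings to those of \<open>P\<close> replaces \<open>m!\<close> by \<open>(n + 1)!\<close>
  (\<open>sum_bijections_independent\<close>).
\<close>

section \<open>Summing over bijections\<close>

definition bijections :: "'a set \<Rightarrow> 'b set \<Rightarrow> ('a \<Rightarrow> 'b) set" where
  "bijections A U = {\<sigma> \<in> A \<rightarrow>\<^sub>E U. bij_betw \<sigma> A U}"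

lemma finite_bijections: "finite A \<Longrightarrow> finite U \<Longrightarrow> finite (bijections A U)"
  unfolding bijections_def by (rule finite_subset[OF _ finite_PiE[of A "\<lambda>_. U"]]) auto

text \<open>A bijection on \<open>A \<union> B\<close> is the choice of the values \<open>U\<close> that it takes on \<open>A\<close>, together with a
  bijection from \<open>A\<close> to \<open>U\<close> and one from \<open>B\<close> to the remaining values.\<close>

lemma sum_bijections_split:
  fixes F G :: "('a \<Rightarrow> 'b) \<Rightarrow> real"
  assumes "finite A" "finite B" "finite V" "A \<inter> B = {}"
  shows "(\<Sum>\<sigma>\<in>bijections (A \<union> B) V. F (restrict \<sigma> A) * G (restrict \<sigma> B)) =
    (\<Sum>U | U \<subseteq> V \<and> card U = card A. sum F (bijections A U) * sum G (bijections B (V - U)))"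
proof -
  let ?S = "SIGMA U:{U. U \<subseteq> V \<and> card U = card A}. bijections A U \<times> bijections B (V - U)"
  let ?glue = "\<lambda>(U, \<alpha>, \<beta>). (\<lambda>x. if x \<in> A then \<alpha> x else \<beta> x)"
  have "(\<Sum>\<sigma>\<in>bijections (A \<union> B) V. F (restrict \<sigma> A) * G (restrict \<sigma> B)) =
      (\<Sum>(U, \<alpha>, \<beta>)\<in>?S. F \<alpha> * G \<beta>)"
  proof (rule sum.reindex_bij_witness[where j = "\<lambda>\<sigma>. (\<sigma> ` A, restrict \<sigma> A, restrict \<sigma> B)" and i = ?glue])
    fix \<sigma> assume s: "\<sigma> \<in> bijections (A \<union> B) V"
    then have b: "inj_on \<sigma> (A \<union> B)" "\<sigma> ` (A \<union> B) = V" and e: "\<sigma> \<in> extensional (A \<union> B)"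
      by (auto simp: bijections_def bij_betw_def PiE_def)
    show "?glue (\<sigma> ` A, restrict \<sigma> A, restrict \<sigma> B) = \<sigma>"
      using e by (auto simp: fun_eq_iff extensional_def)
    have "\<sigma> ` B = V - \<sigma> ` A"
      using b assms(4) by (auto simp: inj_on_def)
    moreover have "inj_on \<sigma> A" "inj_on \<sigma> B" using b(1) by (auto simp: inj_on_def)
    ultimately show "(\<sigma> ` A, restrict \<sigma> A, restrict \<sigma> B) \<in> ?S"
      using b by (auto simp: bijections_def bij_betw_def card_image)
  next
    fix p assume "p \<in> ?S"
    then obtain U \<alpha> \<beta> where p: "p = (U, \<alpha>, \<beta>)" and U: "U \<subseteq> V"
      and \<alpha>: "\<alpha> \<in> bijections A U" and \<beta>: "\<beta> \<in> bijections B (V - U)" by auto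
    have notA: "x \<notin> A" if "x \<in> B" for x using that assms(4) by auto
    let ?g = "\<lambda>x. if x \<in> A then \<alpha> x else \<beta> x"
    have ra: "restrict ?g A = \<alpha>" using \<alpha> by (auto simp: fun_eq_iff bijections_def PiE_def extensional_def)
    have rb: "restrict ?g B = \<beta>" using \<beta> notA by (auto simp: fun_eq_iff bijections_def PiE_def extensional_def)
    have im: "?g ` A = U" using \<alpha> by (auto simp: bijections_def bij_betw_def)
    show "(?glue p ` A, restrict (?glue p) A, restrict (?glue p) B) = p"
      unfolding p using ra rb im by simp
    have "bij_betw ?g A U"
      using \<alpha> by (subst bij_betw_cong[of A ?g \<alpha>]) (auto simp: bijections_def)
    moreover have "bij_betw ?g B (V - U)"
      using \<beta> notA by (subst bij_betw_cong[of B ?g \<beta>]) (auto simp: bijections_def)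
    ultimately have "bij_betw ?g (A \<union> B) (U \<union> (V - U))"
      by (rule bij_betw_combine) auto
    moreover have "U \<union> (V - U) = V" using U by auto
    moreover have "?g \<in> extensional (A \<union> B)"
      using \<beta> by (auto simp: bijections_def PiE_def extensional_def)
    ultimately show "?glue p \<in> bijections (A \<union> B) V"
      unfolding p by (auto simp: bijections_def PiE_def bij_betw_def)
  qed auto
  also have "\<dots> = (\<Sum>U | U \<subseteq> V \<and> card U = card A. \<Sum>(\<alpha>, \<beta>)\<in>bijections A U \<times> bijections B (V - U). F \<alpha> * G \<beta>)"
    using assms by (subst sum.Sigma)
      (auto intro: finite_bijections finite_subset simp: split_def)
  finally show ?thesis
    by (simp add: sum_product sum.cartesian_product)
qed

text \<open>The statistics that matter here depend only on the relative order of the labels, so that their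
  sum over the bijections to a value set depends only on its size. For a uniformly random bijection
  such statistics of two disjoint sets of positions are independent: after conditioning on the set
  of values taken on \<open>A\<close>, the expectations are still \<open>c\<close> and \<open>d\<close>. With \<open>G = 1\<close> this also says
  that positions outside \<open>A\<close> may be forgotten.\<close>

lemma sum_bijections_independent:
  fixes F G :: "('a \<Rightarrow> 'b) \<Rightarrow> real"
  assumes "finite A" "finite B" "finite V" "A \<inter> B = {}" "card V = card A + card B"
    and F: "\<And>U. U \<subseteq> V \<Longrightarrow> card U = card A \<Longrightarrow> sum F (bijections A U) = fact (card A) * c"
    and G: "\<And>U. U \<subseteq> V \<Longrightarrow> card U = card B \<Longrightarrow> sum G (bijections B U) = fact (card B) * d"
  shows "(\<Sum>\<sigma>\<in>bijections (A \<union> B) V. F (restrict \<sigma> A) * G (restrict \<sigma> B)) = fact (card V) * (c * d)"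
proof -
  have "(\<Sum>\<sigma>\<in>bijections (A \<union> B) V. F (restrict \<sigma> A) * G (restrict \<sigma> B)) =
    (\<Sum>U | U \<subseteq> V \<and> card U = card A. (fact (card A) * c) * (fact (card B) * d))"
    unfolding sum_bijections_split[OF assms(1-4)]
  proof (intro sum.cong refl)
    fix U assume "U \<in> {U. U \<subseteq> V \<and> card U = card A}"
    then have U: "U \<subseteq> V" "card U = card A" by auto
    then have "card (V - U) = card B"
      using assms(3,5) by (simp add: card_Diff_subset finite_subset)
    then show "sum F (bijections A U) * sum G (bijections B (V - U)) = (fact (card A) * c) * (fact (card B) * d)"
      using F[OF U] G[of "V - U"] by simp
  qed
  also have "\<dots> = real (card V choose card A) * (fact (card A) * fact (card B)) * (c * d)"
    using n_subsets[OF assms(3), of "card A"] by simp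
  also have "real (card V choose card A) * (fact (card A) * fact (card B)) = fact (card V)"
    using binomial_fact_lemma[of "card A" "card V"] assms(5)
    by (metis add_diff_cancel_left' le_add1 mult.commute of_nat_fact of_nat_mult)
  finally show ?thesis .
qed

lemma sum_bijections_insert:
  fixes H :: "('a \<Rightarrow> 'b) \<Rightarrow> real"
  assumes "finite A" "finite V" "y \<notin> A"
  shows "sum H (bijections (insert y A) V) = (\<Sum>u\<in>V. \<Sum>\<alpha>\<in>bijections A (V - {u}). H (\<alpha>(y := u)))"
proof -
  let ?S = "SIGMA u:V. bijections A (V - {u})"
  have "sum H (bijections (insert y A) V) = (\<Sum>(u, \<alpha>)\<in>?S. H (\<alpha>(y := u)))"
  proof (rule sum.reindex_bij_witness[where j = "\<lambda>\<sigma>. (\<sigma> y, restrict \<sigma> A)" and i = "\<lambda>(u, \<alpha>). \<alpha>(y := u)"])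
    fix \<sigma> assume s: "\<sigma> \<in> bijections (insert y A) V"
    then show e: "(case (\<sigma> y, restrict \<sigma> A) of (u, \<alpha>) \<Rightarrow> \<alpha>(y := u)) = \<sigma>"
      by (auto simp: fun_eq_iff bijections_def PiE_def extensional_def)
    show "(\<sigma> y, restrict \<sigma> A) \<in> ?S"
      using s assms(3) by (auto simp: bijections_def bij_betw_def) (metis image_eqI)+
    show "(case (\<sigma> y, restrict \<sigma> A) of (u, \<alpha>) \<Rightarrow> H (\<alpha>(y := u))) = H \<sigma>"
      using e by simp
  next
    fix p assume "p \<in> ?S"
    then obtain u \<alpha> where p: "p = (u, \<alpha>)" "u \<in> V" "\<alpha> \<in> bijections A (V - {u})" by auto
    show "((case p of (u, \<alpha>) \<Rightarrow> \<alpha>(y := u)) y, restrict (case p of (u, \<alpha>) \<Rightarrow> \<alpha>(y := u)) A) = p"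
      using p assms(3) by (auto simp: fun_eq_iff bijections_def PiE_def extensional_def)
    have "bij_betw (\<alpha>(y := u)) A (V - {u})"
      using p assms(3) by (subst bij_betw_cong[of A _ \<alpha>]) (auto simp: bijections_def)
    then have "bij_betw (\<alpha>(y := u)) (A \<union> {y}) ((V - {u}) \<union> {u})"
      by (rule bij_betw_combine) (auto simp: bij_betw_def)
    then have "bij_betw (\<alpha>(y := u)) (insert y A) V" using p(2) by (simp add: insert_absorb)
    moreover have "\<alpha>(y := u) \<in> extensional (insert y A)"
      using p by (auto simp: bijections_def PiE_def extensional_def)
    ultimately show "(case p of (u, \<alpha>) \<Rightarrow> \<alpha>(y := u)) \<in> bijections (insert y A) V"
      using p by (auto simp: bijections_def PiE_def bij_betw_def)
  qed
  also have "\<dots> = (\<Sum>u\<in>V. \<Sum>\<alpha>\<in>bijections A (V - {u}). H (\<alpha>(y := u)))"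
    using assms by (subst sum.Sigma) (auto intro: finite_bijections)
  finally show ?thesis .
qed

lemma card_bijections:
  assumes "finite A" "finite U" "card A = card U"
  shows "card (bijections A U) = fact (card A)"
  using assms
proof (induction A arbitrary: U rule: finite_induct)
  case empty
  then show ?case by (simp add: bijections_def bij_betw_def)
next
  case (insert y A)
  have "real (card (bijections (insert y A) U)) = (\<Sum>u\<in>U. \<Sum>\<alpha>\<in>bijections A (U - {u}). 1)"
    using sum_bijections_insert[of A U y "\<lambda>_. 1"] insert by simp
  also have "\<dots> = (\<Sum>u\<in>U. fact (card A))"
    using insert by (intro sum.cong refl) (simp flip: insert.prems(2))
  also have "\<dots> = fact (card (insert y A))"
    using insert by (simp flip: insert.prems(2))
  finally show ?case by (metis of_nat_eq_iff of_nat_fact)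
qed


section \<open>Reading the roots of the blocks from left to right\<close>

text \<open>If \<open>x\<close> is the root of the current block, then the next element \<open>y\<close> can join the block
  only when its label is on one side of the label of \<open>x\<close>, and can open a new block only when its label
  is on the other side, since \<open>y\<close> is comparable with its left neighbour. Which side is which depends
  on whether \<open>y\<close> is a descent. So the roots are forced, and they can be read off greedily. The
  positions form an arbitrary list rather than an interval, since elements are going to be
  deleted; \<open>D\<close> is the set of descents.\<close>

definition new_root :: "'a set \<Rightarrow> ('a \<Rightarrow> 'b::linorder) \<Rightarrow> 'a \<Rightarrow> 'a \<Rightarrow> bool" where
  "new_root D \<sigma> x y \<longleftrightarrow> (if y \<in> D then \<sigma> y < \<sigma> x else \<sigma> x < \<sigma> y)"

fun new_roots :: "'a set \<Rightarrow> ('a \<Rightarrow> 'b::linorder) \<Rightarrow> 'a \<Rightarrow> 'a list \<Rightarrow> nat" where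
  "new_roots D \<sigma> x [] = 0"
| "new_roots D \<sigma> x (y # ps) =
     (if new_root D \<sigma> x y then Suc (new_roots D \<sigma> y ps) else new_roots D \<sigma> x ps)"

fun last_root :: "'a set \<Rightarrow> ('a \<Rightarrow> 'b::linorder) \<Rightarrow> 'a \<Rightarrow> 'a list \<Rightarrow> 'a" where
  "last_root D \<sigma> x [] = x"
| "last_root D \<sigma> x (y # ps) = last_root D \<sigma> (if new_root D \<sigma> x y then y else x) ps"

fun roots :: "'a set \<Rightarrow> ('a \<Rightarrow> 'b::linorder) \<Rightarrow> 'a list \<Rightarrow> nat" where
  "roots D \<sigma> [] = 0"
| "roots D \<sigma> (x # ps) = Suc (new_roots D \<sigma> x ps)"

lemma new_roots_append:
  "new_roots D \<sigma> x (ps @ qs) = new_roots D \<sigma> x ps + new_roots D \<sigma> (last_root D \<sigma> x ps) qs"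
  by (induction ps arbitrary: x) auto

lemma last_root_append:
  "last_root D \<sigma> x (ps @ qs) = last_root D \<sigma> (last_root D \<sigma> x ps) qs"
  by (induction ps arbitrary: x) auto

lemma last_root_mem: "last_root D \<sigma> x ps \<in> insert x (set ps)"
proof (induction ps arbitrary: x)
  case (Cons y ps)
  then show ?case using Cons[of x] Cons[of y] by auto
qed simp

lemma new_roots_cong:
  assumes "\<And>y. y \<in> set ps \<Longrightarrow> y \<in> D \<longleftrightarrow> y \<in> D'"
    and "\<And>y. y \<in> insert x (set ps) \<Longrightarrow> \<sigma> y = \<tau> y"
  shows "new_roots D \<sigma> x ps = new_roots D' \<tau> x ps \<and> last_root D \<sigma> x ps = last_root D' \<tau> x ps"
  using assms by (induction ps arbitrary: x) (auto simp: new_root_def)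

lemma roots_cong:
  assumes "\<And>y. y \<in> set (tl ps) \<Longrightarrow> y \<in> D \<longleftrightarrow> y \<in> D'"
    and "\<And>y. y \<in> set ps \<Longrightarrow> \<sigma> y = \<tau> y"
  shows "roots D \<sigma> ps = roots D' \<tau> ps"
  using assms new_roots_cong[of "tl ps" D D' "hd ps" \<sigma> \<tau>] by (cases ps) auto

lemma roots_restrict: "roots D (restrict \<sigma> (set ps)) ps = roots D \<sigma> ps"
  by (intro roots_cong) auto

text \<open>Changing the relation between \<open>y\<close> and its left neighbour exchanges the two possible fates of \<open>y\<close>.
  So among the two fences exactly one has a new block at \<open>y\<close>, and then the parts to the left of \<open>y\<close> and
  from \<open>y\<close> on are read independently; in the other fence \<open>y\<close> joins the current block and has no
  influence on what follows.\<close>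

lemma power_roots_toggle:
  fixes t :: "'c::comm_semiring_1"
  assumes "distinct (ps @ y # qs)" "ps \<noteq> []" "inj_on \<sigma> (set (ps @ y # qs))" "y \<in> D"
  shows "t ^ roots (D - {y}) \<sigma> (ps @ y # qs) + t ^ roots D \<sigma> (ps @ y # qs) =
    t ^ roots D \<sigma> ps * t ^ roots D \<sigma> (y # qs) + t ^ roots D \<sigma> (ps @ qs)"
proof -
  obtain x l where ps: "ps = x # l" using assms(2) by (cases ps) auto
  define r where "r = last_root D \<sigma> x l"
  have "r \<in> set ps" using last_root_mem[of D \<sigma> x l] ps by (auto simp: r_def)
  then have ne: "\<sigma> r \<noteq> \<sigma> y" using assms(1,3) by (auto simp: inj_on_def)
  have l: "new_roots (D - {y}) \<sigma> x l = new_roots D \<sigma> x l"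
    "last_root (D - {y}) \<sigma> x l = r"
    using assms(1) ps new_roots_cong[of l "D - {y}" D x \<sigma> \<sigma>] by (auto simp: r_def)
  have q: "new_roots (D - {y}) \<sigma> z qs = new_roots D \<sigma> z qs" for z
    using assms(1) new_roots_cong[of qs "D - {y}" D z \<sigma> \<sigma>] by auto
  have "\<sigma> y < \<sigma> r \<longleftrightarrow> \<not> \<sigma> r < \<sigma> y" using ne by auto
  then show ?thesis
    using assms(4)
    by (cases "\<sigma> r < \<sigma> y")
      (simp_all add: ps new_roots_append l q new_root_def power_add algebra_simps flip: r_def)
qed

section \<open>Order-preserving maps of a fence\<close>

text \<open>The number of ways to extend an order-preserving map to \<open>{..<t}\<close> along the elements of the
  list, when it takes the value \<open>v\<close> just before them. All inequalities are weak. The order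
  polynomial of the fence is then \<open>order_maps\<close>, where the first element is unconstrained.\<close>

fun extensions :: "nat \<Rightarrow> 'a set \<Rightarrow> nat \<Rightarrow> 'a list \<Rightarrow> nat" where
  "extensions t D v [] = 1"
| "extensions t D v (y # ps) =
     (\<Sum>w\<in>(if y \<in> D then {..v} else {v..<t}). extensions t D w ps)"

fun order_maps :: "nat \<Rightarrow> 'a set \<Rightarrow> 'a list \<Rightarrow> nat" where
  "order_maps t D [] = 1"
| "order_maps t D (x # ps) = (\<Sum>v<t. extensions t D v ps)"

lemma extensions_cong:
  assumes "\<And>y. y \<in> set ps \<Longrightarrow> y \<in> D \<longleftrightarrow> y \<in> D'"
  shows "extensions t D v ps = extensions t D' v ps"
  using assms by (induction ps arbitrary: v) (auto intro!: sum.cong)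

text \<open>The value \<open>w\<close> at \<open>y\<close> ranges over \<open>{v'..<t}\<close> for an ascent and over \<open>{..v'}\<close> for a descent, where
  \<open>v'\<close> is the value just before. Together these ranges cover all values, and \<open>v'\<close> once more: the former
  cuts the fence before \<open>y\<close>, the latter deletes \<open>y\<close>. This is the recursion of \<open>power_roots_toggle\<close>.\<close>

lemma extensions_toggle:
  assumes "distinct (ps @ y # qs)" "y \<in> D" "v < t"
  shows "extensions t (D - {y}) v (ps @ y # qs) + extensions t D v (ps @ y # qs) =
    extensions t D v ps * order_maps t D (y # qs) + extensions t D v (ps @ qs)"
  using assms
proof (induction ps arbitrary: v)
  case Nil
  have q: "extensions t (D - {y}) w qs = extensions t D w qs" for w
    using Nil extensions_cong[of qs "D - {y}" D t w] by auto
  have "(\<Sum>w<t. extensions t D w qs) + extensions t D v qs =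
      (\<Sum>w\<in>{..<v}. extensions t D w qs) + (\<Sum>w\<in>{v..<t}. extensions t D w qs) + extensions t D v qs"
    using Nil(3) by (subst sum.union_disjoint[symmetric]) (auto intro!: sum.cong)
  then show ?case using Nil(2) by (simp add: q lessThan_Suc_atMost[symmetric])
next
  case (Cons x ps)
  let ?W = "if x \<in> D then {..v} else {v..<t}"
  have "(\<Sum>w\<in>?W. extensions t (D - {y}) w (ps @ y # qs) + extensions t D w (ps @ y # qs)) =
      (\<Sum>w\<in>?W. extensions t D w ps * order_maps t D (y # qs) + extensions t D w (ps @ qs))"
    using Cons by (intro sum.cong refl Cons.IH) (auto split: if_splits)
  moreover have "x \<in> D - {y} \<longleftrightarrow> x \<in> D" using Cons.prems by auto
  ultimately show ?case by (simp only: append_Cons extensions.simps sum.distrib sum_distrib_right)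
qed

lemma order_maps_toggle:
  assumes "distinct (ps @ y # qs)" "ps \<noteq> []" "y \<in> D"
  shows "order_maps t (D - {y}) (ps @ y # qs) + order_maps t D (ps @ y # qs) =
    order_maps t D ps * order_maps t D (y # qs) + order_maps t D (ps @ qs)"
proof -
  obtain x l where ps: "ps = x # l" using assms(2) by (cases ps) auto
  have "(\<Sum>v<t. extensions t (D - {y}) v (l @ y # qs) + extensions t D v (l @ y # qs)) =
      (\<Sum>v<t. extensions t D v l * order_maps t D (y # qs) + extensions t D v (l @ qs))"
    using assms ps by (intro sum.cong refl extensions_toggle) auto
  then show ?thesis
    unfolding ps by (simp only: append_Cons order_maps.simps(2) sum.distrib sum_distrib_right)
qed

section \<open>The block statistic and the order polynomial\<close>

text \<open>A chain of ascents has no relation to toggle. Its order-preserving maps are the multisets of values.\<close>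

lemma extensions_chain:
  assumes "set ps \<inter> D = {}" "v < t"
  shows "extensions t D v ps = (t - 1 - v + length ps) choose length ps"
  using assms
proof (induction ps arbitrary: v)
  case (Cons y ps)
  let ?m = "length ps"
  have "extensions t D v (y # ps) = (\<Sum>w\<in>{v..<t}. (t - 1 - w + ?m) choose ?m)"
    using Cons by (auto intro!: sum.cong)
  also have "\<dots> = (\<Sum>j\<le>t - 1 - v. (?m + j) choose ?m)"
    using Cons.prems
    by (intro sum.reindex_bij_witness[where i = "\<lambda>j. t - 1 - j" and j = "\<lambda>w. t - 1 - w"])
      (auto simp: add.commute)
  also have "\<dots> = (\<Sum>j\<le>t - 1 - v. (?m + j) choose j)"
    by (intro sum.cong refl) (simp add: binomial_symmetric[of ?m])
  also have "\<dots> = Suc (?m + (t - 1 - v)) choose (t - 1 - v)"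
    by (rule sum_choose_lower)
  also have "\<dots> = (t - 1 - v + length (y # ps)) choose length (y # ps)"
    using binomial_symmetric[of "t - 1 - v" "Suc (?m + (t - 1 - v))"] by (simp add: add.commute)
  finally show ?case .
qed simp

lemma order_maps_chain:
  assumes "set (tl ps) \<inter> D = {}" "t > 0"
  shows "order_maps t D ps = (t - 1 + length ps) choose length ps"
proof (cases ps)
  case (Cons y l)
  then have "order_maps t D ps = extensions t (D - {y}) 0 (y # l)"
    using assms by (auto simp: lessThan_atLeast0 intro!: sum.cong extensions_cong)
  then show ?thesis using extensions_chain[of ps "D - {y}" 0 t] assms Cons by auto
qed simp

text \<open>On a chain of ascents the roots are the left-to-right maxima of the labels.\<close>

lemma label_last_root_chain:
  assumes "set ps \<inter> D = {}"
  shows "\<sigma> (last_root D \<sigma> x ps) = Max (\<sigma> ` set (x # ps))"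
  using assms
proof (induction ps arbitrary: x)
  case (Cons y ps)
  have "Max (\<sigma> ` set (x # y # ps)) = max (max (\<sigma> x) (\<sigma> y)) (if ps = [] then \<sigma> x else Max (\<sigma> ` set ps))"
    by (auto simp: max.assoc) (auto simp: max_def)
  moreover have "Max (\<sigma> ` set (z # ps)) = max (\<sigma> z) (if ps = [] then \<sigma> z else Max (\<sigma> ` set ps))" for z
    by auto
  ultimately show ?case
    using Cons by (auto simp: new_root_def max_def)
qed simp

text \<open>The last element is a left-to-right maximum exactly when it has the largest of the \<open>m + 1\<close>
  labels, so it contributes a factor \<open>t + m\<close>, and \<open>t (t + 1) \<dots> (t + m)\<close> is \<open>(m + 1)!\<close> times the number
  of weakly increasing sequences.\<close>

lemma sum_power_roots_chain:
  assumes "distinct ps" "set (tl ps) \<inter> D = {}" "finite U" "card U = length ps" "t > 0"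
  shows "(\<Sum>\<sigma>\<in>bijections (set ps) U. real t ^ roots D \<sigma> ps) = fact (length ps) * real (order_maps t D ps)"
  using assms(1-4)
proof (induction ps arbitrary: U rule: rev_induct)
  case Nil
  then show ?case by (simp add: bijections_def bij_betw_def)
next
  case (snoc y ps)
  let ?m = "length ps"
  have dis: "set (tl ps) \<inter> D = {}" using snoc.prems by (cases ps) auto
  have "U \<noteq> {}" using snoc.prems by auto
  have step: "real t ^ roots D (\<alpha>(y := u)) (ps @ [y]) = (if u = Max U then real t else 1) * real t ^ roots D \<alpha> ps"
    if u: "u \<in> U" and \<alpha>: "\<alpha> \<in> bijections (set ps) (U - {u})" for u \<alpha>
  proof (cases ps)
    case Nil
    then have "U = {u}" using u snoc.prems by (auto simp: card_1_singleton_iff)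
    then show ?thesis using Nil by simp
  next
    case (Cons x l)
    have "roots D (\<alpha>(y := u)) ps = roots D \<alpha> ps"
      using snoc.prems by (intro roots_cong) auto
    moreover have "last_root D (\<alpha>(y := u)) x l = last_root D \<alpha> x l"
      using snoc.prems Cons by (intro new_roots_cong[THEN conjunct2]) auto
    moreover have "last_root D \<alpha> x l \<noteq> y"
      using snoc.prems Cons last_root_mem[of D \<alpha> x l] by auto
    moreover have "\<alpha> (last_root D \<alpha> x l) = Max (U - {u})"
      using label_last_root_chain[of l D \<alpha> x] dis \<alpha> Cons by (auto simp: bijections_def bij_betw_def)
    \<comment> \<open>So \<open>y\<close> opens a new block exactly when its label \<open>u\<close> is the largest one.\<close>
    moreover have "Max (U - {u}) < u \<longleftrightarrow> u = Max U"
    proof -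
      have ne: "U - {u} \<noteq> {}" using \<alpha> Cons by (auto simp: bijections_def bij_betw_def)
      then have "Max U = max u (Max (U - {u}))"
        using Max_insert[of "U - {u}" u] snoc.prems(3) u by (simp add: insert_absorb)
      moreover have "Max (U - {u}) \<noteq> u" using Max_in[OF _ ne] snoc.prems(3) by auto
      ultimately show ?thesis by (auto simp: max_def)
    qed
    moreover have "y \<notin> D" using snoc.prems Cons by auto
    ultimately show ?thesis
      using Cons by (auto simp: new_roots_append new_root_def)
  qed
  have "(\<Sum>\<sigma>\<in>bijections (set (ps @ [y])) U. real t ^ roots D \<sigma> (ps @ [y])) =
      (\<Sum>u\<in>U. \<Sum>\<alpha>\<in>bijections (set ps) (U - {u}). (if u = Max U then real t else 1) * real t ^ roots D \<alpha> ps)"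
    using snoc.prems sum_bijections_insert[of "set ps" U y "\<lambda>\<sigma>. real t ^ roots D \<sigma> (ps @ [y])"]
    by (simp add: step cong: sum.cong)
  also have "\<dots> = (\<Sum>u\<in>U. (if u = Max U then real t else 1) * (fact ?m * real (order_maps t D ps)))"
    using snoc.prems dis by (intro sum.cong refl) (simp add: snoc.IH flip: sum_distrib_left)
  also have "\<dots> = (\<Sum>u\<in>U. if u = Max U then real t else 1) * (fact ?m * real (order_maps t D ps))"
    by (simp add: sum_distrib_right)
  also have "(\<Sum>u\<in>U. if u = Max U then real t else 1) = real (t + ?m)"
  proof -
    have "(\<Sum>u\<in>U. if u = Max U then real t else 1) = real t + (\<Sum>u\<in>U - {Max U}. if u = Max U then real t else 1)"
      using snoc.prems(3) \<open>U \<noteq> {}\<close> by (subst sum.remove[of U "Max U"]) auto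
    also have "(\<Sum>u\<in>U - {Max U}. if u = Max U then real t else 1) = (\<Sum>u\<in>U - {Max U}. 1)"
      by (intro sum.cong) auto
    finally show ?thesis
      using snoc.prems(3,4) \<open>U \<noteq> {}\<close> by (simp add: card_Diff_singleton)
  qed
  also have "real (t + ?m) * (fact ?m * real (order_maps t D ps)) =
      fact (Suc ?m) * real (order_maps t D (ps @ [y]))"
  proof -
    have "(t + ?m) * ((t - 1 + ?m) choose ?m) = Suc ?m * ((t - 1 + Suc ?m) choose Suc ?m)"
      using Suc_times_binomial_eq[of "t - 1 + ?m" ?m] assms(5) by simp
    then have "(t + ?m) * order_maps t D ps = Suc ?m * order_maps t D (ps @ [y])"
      using order_maps_chain[OF dis assms(5)] order_maps_chain[OF snoc.prems(2) assms(5)] by simp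
    then have "real (t + ?m) * real (order_maps t D ps) = real (Suc ?m) * real (order_maps t D (ps @ [y]))"
      by (metis of_nat_mult)
    then show ?thesis by (simp add: algebra_simps)
  qed
  finally show ?case by simp
qed

text \<open>Both sides obey the same recursion under toggling a descent, which expresses them by fences with
  fewer descents or fewer elements. Cutting the fence at the toggled element makes the sum over
  labelings factor because the labels on the two sides are independent.\<close>

theorem sum_power_roots:
  assumes "distinct ps" "finite U" "card U = length ps" "t > 0"
  shows "(\<Sum>\<sigma>\<in>bijections (set ps) U. real t ^ roots D \<sigma> ps) = fact (length ps) * real (order_maps t D ps)"
  using assms(1-3)
proof (induction "length ps + card (set (tl ps) \<inter> D)" arbitrary: ps D U rule: less_induct)
  case less
  show ?case
  proof (cases "set (tl ps) \<inter> D = {}")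
    case True
    then show ?thesis using less.prems assms(4) by (intro sum_power_roots_chain) auto
  next
    case False
    then obtain y where y: "y \<in> set (tl ps)" "y \<in> D" by auto
    then obtain l qs where "tl ps = l @ y # qs" by (meson split_list)
    then have eq: "ps = (hd ps # l) @ y # qs" using y by (cases ps) auto
    define ls where "ls = hd ps # l"
    have ps: "ps = ls @ y # qs" and ne: "ls \<noteq> []" using eq by (simp_all add: ls_def)
    let ?f = "\<lambda>ps D \<sigma>. real t ^ roots D \<sigma> ps"
    have tl: "tl ps = tl ls @ y # qs" "tl (ls @ qs) = tl ls @ qs" using ps ne by auto
    have fin: "finite (set (tl ps) \<inter> D)" by simp
    \<comment> \<open>With the relation at \<open>y\<close> reversed there is one descent less.\<close>
    have IH1: "(\<Sum>\<sigma>\<in>bijections (set ps) U. ?f ps (D - {y}) \<sigma>) = fact (length ps) * real (order_maps t (D - {y}) ps)"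
    proof (rule less.hyps)
      have "set (tl ps) \<inter> (D - {y}) \<subset> set (tl ps) \<inter> D" using y by auto
      then have "card (set (tl ps) \<inter> (D - {y})) < card (set (tl ps) \<inter> D)" by (rule psubset_card_mono[OF fin])
      then show "length ps + card (set (tl ps) \<inter> (D - {y})) < length ps + card (set (tl ps) \<inter> D)" by simp
    qed (use less.prems in auto)
    have IH: "(\<Sum>\<sigma>\<in>bijections (set rs) V. ?f rs D \<sigma>) = fact (card (set rs)) * real (order_maps t D rs)"
      if "distinct rs" "length rs < length ps" "set (tl rs) \<subseteq> set (tl ps)" "V \<subseteq> U" "card V = card (set rs)" for rs V
    proof -
      have "card (set (tl rs) \<inter> D) \<le> card (set (tl ps) \<inter> D)" using that fin by (intro card_mono) auto
      then show ?thesis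
        using that less.hyps[of rs D V] less.prems finite_subset[of V U] by (simp add: distinct_card)
    qed
    \<comment> \<open>The fence cut before \<open>y\<close>.\<close>
    have A: "(\<Sum>\<sigma>\<in>bijections (set ps) U. ?f ls D \<sigma> * ?f (y # qs) D \<sigma>) =
        fact (length ps) * (real (order_maps t D ls) * real (order_maps t D (y # qs)))"
    proof -
      have "(\<Sum>\<sigma>\<in>bijections (set ls \<union> set (y # qs)) U.
            ?f ls D (restrict \<sigma> (set ls)) * ?f (y # qs) D (restrict \<sigma> (set (y # qs)))) =
          fact (card U) * (real (order_maps t D ls) * real (order_maps t D (y # qs)))"
      proof (rule sum_bijections_independent)
        show "card U = card (set ls) + card (set (y # qs))"
          using less.prems ps by (simp add: distinct_card)
        show "set ls \<inter> set (y # qs) = {}" using less.prems ps by auto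
      next
        fix V assume "V \<subseteq> U" "card V = card (set ls)"
        then show "sum (?f ls D) (bijections (set ls) V) = fact (card (set ls)) * real (order_maps t D ls)"
          using less.prems ps tl by (intro IH) auto
      next
        fix V assume "V \<subseteq> U" "card V = card (set (y # qs))"
        then show "sum (?f (y # qs) D) (bijections (set (y # qs)) V) =
            fact (card (set (y # qs))) * real (order_maps t D (y # qs))"
          using less.prems ps tl ne by (intro IH) auto
      qed (use less.prems in auto)
      moreover have "set ps = set ls \<union> set (y # qs)" unfolding ps by simp
      ultimately show ?thesis by (simp only: roots_restrict less.prems(3))
    qed
    \<comment> \<open>The fence with \<open>y\<close> deleted.\<close>
    have B: "(\<Sum>\<sigma>\<in>bijections (set ps) U. ?f (ls @ qs) D \<sigma>) = fact (length ps) * real (order_maps t D (ls @ qs))"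
    proof -
      have "(\<Sum>\<sigma>\<in>bijections (set (ls @ qs) \<union> {y}) U. ?f (ls @ qs) D (restrict \<sigma> (set (ls @ qs))) * 1) =
          fact (card U) * (real (order_maps t D (ls @ qs)) * 1)"
      proof (rule sum_bijections_independent)
        show "card U = card (set (ls @ qs)) + card {y}"
          using less.prems ps distinct_card[of "ls @ qs"] by auto
        show "set (ls @ qs) \<inter> {y} = {}" using less.prems ps by auto
      next
        fix V assume "V \<subseteq> U" "card V = card (set (ls @ qs))"
        then show "sum (?f (ls @ qs) D) (bijections (set (ls @ qs)) V) =
            fact (card (set (ls @ qs))) * real (order_maps t D (ls @ qs))"
          using less.prems ps tl by (intro IH) auto
      next
        fix V assume "V \<subseteq> U" "card V = card {y}"
        then show "(\<Sum>\<sigma>\<in>bijections {y} V. 1) = fact (card {y}) * (1::real)"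
          using less.prems(2) finite_subset[of V U] by (simp add: card_bijections)
      qed (use less.prems in auto)
      moreover have "set ps = set (ls @ qs) \<union> {y}" unfolding ps by auto
      ultimately show ?thesis by (simp only: roots_restrict less.prems(3) mult_1_right)
    qed
    have "(\<Sum>\<sigma>\<in>bijections (set ps) U. ?f ps (D - {y}) \<sigma> + ?f ps D \<sigma>) =
        (\<Sum>\<sigma>\<in>bijections (set ps) U. ?f ls D \<sigma> * ?f (y # qs) D \<sigma> + ?f (ls @ qs) D \<sigma>)"
    proof (intro sum.cong refl)
      fix \<sigma> assume "\<sigma> \<in> bijections (set ps) U"
      then have "inj_on \<sigma> (set ps)" by (auto simp: bijections_def bij_betw_def)
      then show "?f ps (D - {y}) \<sigma> + ?f ps D \<sigma> = ?f ls D \<sigma> * ?f (y # qs) D \<sigma> + ?f (ls @ qs) D \<sigma>"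
        using power_roots_toggle[of ls y qs \<sigma> D "real t"] less.prems ps ne y by simp
    qed
    also have "\<dots> = fact (length ps) * (real (order_maps t D ls * order_maps t D (y # qs) + order_maps t D (ls @ qs)))"
      by (simp only: sum.distrib A B of_nat_add of_nat_mult distrib_left)
    also have "\<dots> = fact (length ps) * real (order_maps t (D - {y}) ps + order_maps t D ps)"
      using order_maps_toggle[of ls y qs D t] less.prems ps ne y by simp
    finally show ?thesis
      using IH1 by (simp add: sum.distrib distrib_left)
  qed
qed

section \<open>Existence and uniqueness of the valid block partition\<close>

definition root_of :: "nat set \<Rightarrow> (nat \<Rightarrow> 'b::linorder) \<Rightarrow> nat \<Rightarrow> nat \<Rightarrow> nat" where
  "root_of D \<sigma> a i = last_root D \<sigma> a [Suc a..<Suc i]"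

lemma root_of_start [simp]: "root_of D \<sigma> a a = a"
  by (simp add: root_of_def)

lemma root_of_Suc:
  "a \<le> i \<Longrightarrow> root_of D \<sigma> a (Suc i) =
    (if new_root D \<sigma> (root_of D \<sigma> a i) (Suc i) then Suc i else root_of D \<sigma> a i)"
  by (simp add: root_of_def last_root_append del: upt_Suc add: upt_Suc_append)

lemma root_of_le: "a \<le> i \<Longrightarrow> root_of D \<sigma> a i \<in> {a..i}"
  by (induction i rule: dec_induct) (auto simp: root_of_Suc)

lemma root_of_root_of: "a \<le> i \<Longrightarrow> root_of D \<sigma> a (root_of D \<sigma> a i) = root_of D \<sigma> a i"
  by (induction i rule: dec_induct) (auto simp: root_of_Suc)

lemma root_of_mono:
  assumes "a \<le> i" "i \<le> j"
  shows "root_of D \<sigma> a i \<le> root_of D \<sigma> a j"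
  using assms(2,1)
proof (induction j rule: dec_induct)
  case (step j)
  then show ?case using root_of_le[of a j D \<sigma>] by (auto simp: root_of_Suc)
qed simp

lemma root_of_between:
  assumes "a \<le> i" "root_of D \<sigma> a i \<le> j" "j \<le> i"
  shows "root_of D \<sigma> a j = root_of D \<sigma> a i"
proof (rule antisym)
  have "a \<le> root_of D \<sigma> a i" using root_of_le[OF assms(1)] by auto
  then show "root_of D \<sigma> a j \<le> root_of D \<sigma> a i" "root_of D \<sigma> a i \<le> root_of D \<sigma> a j"
    using assms root_of_mono[of a j i D \<sigma>] root_of_mono[of a "root_of D \<sigma> a i" j D \<sigma>]
    by (auto simp: root_of_root_of)
qed

lemma not_new_root_within_block:
  assumes "a \<le> i" "root_of D \<sigma> a i \<noteq> i"
  shows "\<not> new_root D \<sigma> (root_of D \<sigma> a i) i"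
proof -
  have "a < i" using assms by (cases "a = i") auto
  then obtain i' where "i = Suc i'" "a \<le> i'" by (cases i) auto
  then show ?thesis using assms(2) by (auto simp: root_of_Suc split: if_splits)
qed

lemma roots_eq_card_root_of: "roots D \<sigma> [a..<b] = card (root_of D \<sigma> a ` {a..<b})"
proof (cases "a < b")
  case True
  then have "Suc a \<le> b" by simp
  then have "Suc (new_roots D \<sigma> a [Suc a..<b]) = card (root_of D \<sigma> a ` {a..<b})"
  proof (induction b rule: dec_induct)
    case base
    have "{a..<Suc a} = {a}" by auto
    then show ?case by simp
  next
    case (step b)
    obtain b' where b': "b = Suc b'" "a \<le> b'" using step(1) by (cases b) auto
    have "{a..<Suc b} = insert b {a..<b}" using step(1) by auto
    moreover have "b \<notin> root_of D \<sigma> a ` {a..<b}" using root_of_le[of a _ D \<sigma>] by force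
    moreover have "last_root D \<sigma> a [Suc a..<b] = root_of D \<sigma> a b'" by (simp add: root_of_def b')
    moreover have "root_of D \<sigma> a b' \<in> root_of D \<sigma> a ` {a..<b}" using b' by auto
    moreover have "root_of D \<sigma> a b = (if new_root D \<sigma> (root_of D \<sigma> a b') b then b else root_of D \<sigma> a b')"
      using b' root_of_Suc[of a b' D \<sigma>] by simp
    moreover have "[Suc a..<Suc b] = [Suc a..<b] @ [b]" using step(1) by simp
    ultimately show ?case
      using step.IH by (cases "new_root D \<sigma> (root_of D \<sigma> a b') b")
        (simp_all add: new_roots_append insert_absorb del: upt_Suc)
  qed
  then show ?thesis using True by (simp add: upt_conv_Cons)
qed simp

lemma fence_less_adjacent:
  assumes "i \<in> elts Q" "Suc i \<in> elts Q"
  shows "Suc i \<in> desc Q \<Longrightarrow> (Suc i, i) \<in> fence_less Q"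
    and "Suc i \<notin> desc Q \<Longrightarrow> (i, Suc i) \<in> fence_less Q"
  using assms by (auto simp: fence_less_def asc_def intro!: r_into_trancl)

definition root_blocks :: "nat set \<Rightarrow> (nat \<Rightarrow> 'b::linorder) \<Rightarrow> nat \<Rightarrow> nat \<Rightarrow> nat set set" where
  "root_blocks D \<sigma> a b = (\<lambda>r. {i \<in> {a..<b}. root_of D \<sigma> a i = r}) ` root_of D \<sigma> a ` {a..<b}"

text \<open>Roots never move to the left and every root is its own root, so the elements that share a root are
  consecutive and begin with it.\<close>

lemma root_block_interval:
  assumes "i \<in> {a..<b}"
  obtains m where "{j \<in> {a..<b}. root_of D \<sigma> a j = root_of D \<sigma> a i} = {root_of D \<sigma> a i..m}"
    and "root_of D \<sigma> a i \<le> m"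
proof -
  let ?c = "root_of D \<sigma> a"
  let ?B = "{j \<in> {a..<b}. ?c j = ?c i}"
  have fin: "finite ?B" and ne: "?B \<noteq> {}" using assms by auto
  have m: "Max ?B \<in> ?B" using Max_in[OF fin ne] .
  have "?B = {?c i..Max ?B}"
  proof
    show "?B \<subseteq> {?c i..Max ?B}"
    proof
      fix j assume j: "j \<in> ?B"
      then have "?c i \<le> j" using root_of_le[of a j D \<sigma>] by auto
      then show "j \<in> {?c i..Max ?B}" using Max_ge[OF fin j] by simp
    qed
    show "{?c i..Max ?B} \<subseteq> ?B"
    proof
      fix j assume j: "j \<in> {?c i..Max ?B}"
      then have "a \<le> j" using root_of_le[of a i D \<sigma>] assms by auto
      moreover have "?c j = ?c i" using j m root_of_between[of a "Max ?B" D \<sigma> j] by auto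
      ultimately show "j \<in> ?B" using j m by auto
    qed
  qed
  then show thesis using that m root_of_le[of a "Max ?B" D \<sigma>] by auto
qed

text \<open>Along a covering relation the root either stays the same or changes in the direction of the
  relation, so validity between adjacent blocks already implies it between comparable distant ones.\<close>

lemma label_root_of_fence_less:
  fixes \<sigma> :: "nat \<Rightarrow> int"
  assumes Q: "elts Q = {a..<b}" and yz: "(y, z) \<in> fence_less Q"
  shows "y \<in> {a..<b} \<and> z \<in> {a..<b} \<and>
    \<sigma> (root_of (desc Q) \<sigma> a y) \<le> \<sigma> (root_of (desc Q) \<sigma> a z)"
proof -
  let ?rel = "\<lambda>y z. y \<in> {a..<b} \<and> z \<in> {a..<b} \<and>
    \<sigma> (root_of (desc Q) \<sigma> a y) \<le> \<sigma> (root_of (desc Q) \<sigma> a z)"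
  let ?R = "{(i, Suc i) | i. i \<in> elts Q \<and> Suc i \<in> elts Q \<and> Suc i \<in> asc Q} \<union>
    {(Suc i, i) | i. i \<in> elts Q \<and> Suc i \<in> elts Q \<and> Suc i \<in> desc Q}"
  have "?rel u v" if "(u, v) \<in> ?R" for u v
    using that Q by (auto simp: root_of_Suc new_root_def asc_def)
  note adjacent = this
  show ?thesis
    using yz unfolding fence_less_def
  proof (induction rule: trancl_induct)
    case (base z)
    then show ?case by (rule adjacent)
  next
    case (step z w)
    then show ?case using adjacent[of z w] by linarith
  qed
qed

lemma valid_root_blocks:
  fixes \<sigma> :: "nat \<Rightarrow> int"
  assumes Q: "elts Q = {a..<b}" and inj: "inj_on \<sigma> {a..<b}"
  shows "valid_block_partition Q \<sigma> (root_blocks (desc Q) \<sigma> a b)"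
proof -
  let ?c = "root_of (desc Q) \<sigma> a"
  let ?\<B> = "root_blocks (desc Q) \<sigma> a b"
  let ?B = "\<lambda>i. {j \<in> {a..<b}. ?c j = ?c i}"
  have blocks: "\<exists>i\<in>{a..<b}. B = ?B i" if "B \<in> ?\<B>" for B
    using that by (auto simp: root_blocks_def)
  have min: "Min (?B i) = ?c i" if i: "i \<in> {a..<b}" for i
  proof -
    obtain m where "?B i = {?c i..m}" "?c i \<le> m" using root_block_interval[OF i] .
    then show ?thesis by (simp only:) (intro Min_eqI; simp)
  qed
  have c_in: "?c i \<in> {a..<b}" if "i \<in> {a..<b}" for i
    using that root_of_le[of a i "desc Q" \<sigma>] by auto
  have "partition_on (elts Q) ?\<B>"
    unfolding Q by (rule partition_onI) (auto simp: root_blocks_def disjnt_def)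
  moreover have "is_block Q \<sigma> B" if B_in: "B \<in> ?\<B>" for B
  proof -
    obtain i where i: "i \<in> {a..<b}" and B: "B = ?B i" using blocks[OF B_in] by auto
    obtain m where m: "?B i = {?c i..m}" "?c i \<le> m" using root_block_interval[OF i] .
    have "(y \<in> asc Q \<longrightarrow> \<sigma> y < \<sigma> (?c i)) \<and> (y \<in> desc Q \<longrightarrow> \<sigma> y > \<sigma> (?c i))"
      if y: "y \<in> ?B i - {?c i}" for y
    proof -
      have "\<sigma> y \<noteq> \<sigma> (?c i)" using y i c_in[of i] inj by (auto simp: inj_on_def)
      moreover have "\<not> new_root (desc Q) \<sigma> (?c i) y"
        using y not_new_root_within_block[of a y "desc Q" \<sigma>] by auto
      ultimately show ?thesis by (auto simp: new_root_def asc_def)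
    qed
    then show ?thesis
      unfolding is_block_def B min[OF i] using m Q by blast
  qed
  moreover have "\<sigma> (Min B) < \<sigma> (Min C)"
    if BC: "B \<in> ?\<B>" "C \<in> ?\<B>" "B \<noteq> C" and yz: "y \<in> B" "z \<in> C" "(y, z) \<in> fence_less Q" for B C y z
  proof -
    obtain i where i: "i \<in> {a..<b}" "B = ?B i" using blocks[OF BC(1)] by blast
    obtain j where j: "j \<in> {a..<b}" "C = ?B j" using blocks[OF BC(2)] by blast
    have "?c i \<noteq> ?c j" using i j BC(3) by auto
    then have "\<sigma> (?c i) \<noteq> \<sigma> (?c j)" using c_in[OF i(1)] c_in[OF j(1)] inj by (auto simp: inj_on_def)
    moreover have "\<sigma> (?c i) \<le> \<sigma> (?c j)"
      using label_root_of_fence_less[OF Q yz(3), of \<sigma>] yz i j by auto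
    ultimately show ?thesis using min i j by auto
  qed
  ultimately show ?thesis unfolding valid_block_partition_def by blast
qed

text \<open>By induction on \<open>i\<close>, the block that contains \<open>i\<close> in a valid partition begins at \<open>root_of i\<close>:
  whether \<open>i + 1\<close> stays in the block of \<open>i\<close> is decided by the block condition in one case and by validity
  for the comparable pair \<open>i\<close>, \<open>i + 1\<close> in the other.\<close>

lemma valid_block_partition_unique:
  fixes \<sigma> :: "nat \<Rightarrow> int"
  assumes Q: "elts Q = {a..<b}" and valid: "valid_block_partition Q \<sigma> \<B>"
  shows "\<B> = root_blocks (desc Q) \<sigma> a b"
proof -
  let ?c = "root_of (desc Q) \<sigma> a"
  have part: "partition_on {a..<b} \<B>" and block: "\<And>B. B \<in> \<B> \<Longrightarrow> is_block Q \<sigma> B"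
    and ord: "\<And>B C y z. B \<in> \<B> \<Longrightarrow> C \<in> \<B> \<Longrightarrow> B \<noteq> C \<Longrightarrow> y \<in> B \<Longrightarrow> z \<in> C \<Longrightarrow> (y, z) \<in> fence_less Q \<Longrightarrow>
      \<sigma> (Min B) < \<sigma> (Min C)"
    using valid unfolding valid_block_partition_def Q by blast+
  have cover: "\<exists>B. B \<in> \<B> \<and> i \<in> B" if "i \<in> {a..<b}" for i
    using part that unfolding partition_on_def by blast
  have block_labels: "(y \<in> asc Q \<longrightarrow> \<sigma> y < \<sigma> (Min B)) \<and> (y \<in> desc Q \<longrightarrow> \<sigma> y > \<sigma> (Min B))"
    if "B \<in> \<B>" "y \<in> B - {Min B}" for B y
    using block[OF that(1)] that(2) unfolding is_block_def by blast
  have dis: "B = C" if "B \<in> \<B>" "C \<in> \<B>" "i \<in> B" "i \<in> C" for B C i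
    using part that by (auto simp: partition_on_def disjoint_def)
  have sub: "B \<subseteq> {a..<b}" if "B \<in> \<B>" for B using part that by (auto simp: partition_on_def)
  have ivl: "\<exists>p q. p \<le> q \<and> B = {p..q} \<and> Min B = p" if "B \<in> \<B>" for B
    using block[OF that] unfolding is_block_def
    by (metis Min_eqI atLeastAtMost_iff finite_atLeastAtMost order_refl)
  have min: "Min B = ?c i" if "a \<le> i" "i \<in> B" "B \<in> \<B>" for i B
    using that
  proof (induction i arbitrary: B rule: dec_induct)
    case base
    then show ?case using ivl[of B] sub[of B] by fastforce
  next
    case (step i)
    have "Suc i < b" using sub[OF step.prems(2)] step.prems(1) by auto
    then have i_in: "i \<in> {a..<b}" and Suc_i_in: "Suc i \<in> {a..<b}" using step by auto
    then obtain C where C: "C \<in> \<B>" "i \<in> C" using cover[OF i_in] by blast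
    have c: "Min C = ?c i" using step.IH C by auto
    obtain p q where B: "p \<le> q" "B = {p..q}" "Min B = p" using ivl[OF step.prems(2)] by auto
    have el: "i \<in> elts Q" "Suc i \<in> elts Q" using i_in Suc_i_in Q by auto
    show ?case
    proof (cases "B = C")
      case True
      then have "Suc i \<in> B - {Min B}" using B C step by auto
      then have "\<not> new_root (desc Q) \<sigma> (?c i) (Suc i)"
        using c el True block_labels[OF step.prems(2), of "Suc i"]
        by (auto simp: new_root_def asc_def)
      then show ?thesis using True c step by (auto simp: root_of_Suc)
    next
      case False
      then have "i \<notin> B" using dis C step.prems by auto
      then have p: "p = Suc i" using B step by auto
      have "new_root (desc Q) \<sigma> (?c i) (Suc i)"
        using fence_less_adjacent[OF el] False C step.prems
          ord[of B C "Suc i" i] ord[of C B i "Suc i"] c p B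
        by (auto simp: new_root_def)
      then show ?thesis using p B step by (auto simp: root_of_Suc)
    qed
  qed
  have fiber: "B = {j \<in> {a..<b}. ?c j = ?c i}" if B: "B \<in> \<B>" and i: "i \<in> B" for B i
  proof
    show "B \<subseteq> {j \<in> {a..<b}. ?c j = ?c i}"
    proof
      fix j assume j: "j \<in> B"
      have "a \<le> i" "a \<le> j" using i j sub[OF B] by auto
      then have "?c j = Min B" "?c i = Min B" using min[OF _ j B] min[OF _ i B] by simp_all
      then show "j \<in> {j \<in> {a..<b}. ?c j = ?c i}" using j sub[OF B] by auto
    qed
    show "{j \<in> {a..<b}. ?c j = ?c i} \<subseteq> B"
    proof
      fix j assume j: "j \<in> {j \<in> {a..<b}. ?c j = ?c i}"
      then obtain C where C: "C \<in> \<B>" "j \<in> C" using cover by blast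
      have "a \<le> i" "a \<le> j" using i j sub[OF B] by auto
      then have "Min C = Min B" using min[OF _ C(2,1)] min[OF _ i B] j by simp
      moreover have "Min C \<in> C" "Min B \<in> B" using ivl[OF C(1)] ivl[OF B] by auto
      ultimately show "j \<in> B" using dis C B by metis
    qed
  qed
  show ?thesis
  proof
    show "\<B> \<subseteq> root_blocks (desc Q) \<sigma> a b"
    proof
      fix B assume B: "B \<in> \<B>"
      then obtain i where "i \<in> B" using part unfolding partition_on_def by (metis ex_in_conv)
      then show "B \<in> root_blocks (desc Q) \<sigma> a b"
        using fiber[OF B] sub[OF B] unfolding root_blocks_def by blast
    qed
    show "root_blocks (desc Q) \<sigma> a b \<subseteq> \<B>"
    proof
      fix B assume "B \<in> root_blocks (desc Q) \<sigma> a b"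
      then obtain i where i: "i \<in> {a..<b}" "B = {j \<in> {a..<b}. ?c j = ?c i}"
        by (auto simp: root_blocks_def)
      then obtain C where "C \<in> \<B>" "i \<in> C" using cover by blast
      then show "B \<in> \<B>" using fiber i by metis
    qed
  qed
qed

theorem bl_eq_roots:
  assumes Q: "elts Q = {a..<b}" and inj: "inj_on \<sigma> {a..<b}"
  shows "bl Q \<sigma> = roots (desc Q) \<sigma> [a..<b]"
proof -
  let ?c = "root_of (desc Q) \<sigma> a"
  have "(THE \<B>. valid_block_partition Q \<sigma> \<B>) = root_blocks (desc Q) \<sigma> a b"
    using valid_root_blocks[OF Q inj] valid_block_partition_unique[OF Q] by (rule the_equality)
  moreover have "inj_on (\<lambda>r. {i \<in> {a..<b}. ?c i = r}) (?c ` {a..<b})"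
    by (rule inj_onI) blast
  ultimately show ?thesis
    by (simp add: bl_def root_blocks_def card_image roots_eq_card_root_of)
qed

section \<open>Maps vanishing at both ends\<close>

text \<open>As \<open>extensions\<close>, but the map must end in the value \<open>0\<close>. For \<open>v = 0\<close> and the list
  of \<open>1, \<dots>, n\<close> this counts the order-preserving maps on a fence with elements \<open>0, \<dots>, n\<close> that vanish
  at both ends.\<close>

fun closed_walks :: "nat \<Rightarrow> 'a set \<Rightarrow> nat \<Rightarrow> 'a list \<Rightarrow> nat" where
  "closed_walks t D v [] = (if v = 0 then 1 else 0)"
| "closed_walks t D v (y # ps) =
     (\<Sum>w\<in>(if y \<in> D then {..v} else {v..<t}). closed_walks t D w ps)"

lemma closed_walks_cong:
  assumes "\<And>y. y \<in> set ps \<Longrightarrow> y \<in> D \<longleftrightarrow> y \<in> D'"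
  shows "closed_walks t D v ps = closed_walks t D' v ps"
  using assms by (induction ps arbitrary: v) (auto intro!: sum.cong)

lemma closed_walks_snoc:
  "v < t \<Longrightarrow> closed_walks t D v (ps @ [y]) =
    (if y \<in> D then extensions t D v ps else closed_walks t D v ps)"
proof (induction ps arbitrary: v)
  case Nil
  then show ?case by (auto simp: sum.delta)
next
  case (Cons x ps)
  let ?W = "if x \<in> D then {..v} else {v..<t}"
  have "(\<Sum>w\<in>?W. closed_walks t D w (ps @ [y])) =
      (\<Sum>w\<in>?W. if y \<in> D then extensions t D w ps else closed_walks t D w ps)"
    using Cons.prems by (intro sum.cong refl Cons.IH) (auto split: if_splits)
  then show ?case by simp
qed

lemma closed_walks_final_ascents:
  "set qs \<inter> D = {} \<Longrightarrow> v < t \<Longrightarrow> closed_walks t D v (ps @ qs) = closed_walks t D v ps"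
proof (induction qs rule: rev_induct)
  case (snoc y qs)
  then show ?case using closed_walks_snoc[of v t D "ps @ qs" y] by simp
qed simp

lemma closed_walks_initial_descents:
  "set ps \<subseteq> D \<Longrightarrow> closed_walks t D 0 (ps @ qs) = closed_walks t D 0 qs"
  by (induction ps) auto

text \<open>The value \<open>0\<close> at the left end forces \<open>0\<close> on the descents that follow it, and the value \<open>0\<close> at the
  right end forces \<open>0\<close> on the whole ascending run that ends there, down to its bottom element. The
  neighbours of these two branches lie above them, so that the rest of the map is free: what remains
  are the order-preserving maps on the truncated fence.\<close>

lemma closed_walks_eq_order_maps:
  assumes "i \<le> n" "j \<le> n" "t > 0"
    and left: "{1..i} \<subseteq> D" "i = n \<or> Suc i \<notin> D"
    and right: "{j<..n} \<inter> D = {}" "j = 0 \<or> j \<in> D"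
  shows "closed_walks t D 0 [1..<Suc n] = order_maps t D [Suc i..<j]"
proof -
  have "[1..<Suc n] = [1..<Suc i] @ [Suc i..<Suc n]"
    using assms(1) by (metis Suc_le_mono One_nat_def le_add_diff_inverse upt_add_eq_append le_add1 plus_1_eq_Suc)
  then have l: "closed_walks t D 0 [1..<Suc n] = closed_walks t D 0 [Suc i..<Suc n]"
    using left(1) by (simp add: closed_walks_initial_descents atLeastLessThanSuc_atLeastAtMost del: upt_Suc)
  show ?thesis
  proof (cases "j \<le> i")
    case True
    then have "set [Suc i..<Suc n] \<subseteq> {j<..n}" by auto
    then have "set [Suc i..<Suc n] \<inter> D = {}" using right(1) by blast
    then show ?thesis
      using closed_walks_final_ascents[of "[Suc i..<Suc n]" D 0 t "[]"] assms(3) True l by simp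
  next
    case False
    \<comment> \<open>The neighbours of the two branches: \<open>i + 1\<close> lies above \<open>i\<close>, and \<open>j\<close> lies below \<open>j - 1\<close>.\<close>
    then have i: "Suc i \<notin> D" and j: "j \<in> D" using left right assms(2) by auto
    then have ij: "Suc i < j" using False by (cases "Suc i = j") auto
    have "[Suc i..<Suc n] = [Suc i..<j] @ [j..<Suc n]"
      using ij assms(2) upt_add_eq_append[of "Suc i" j "Suc n - j"] by simp
    also have "[j..<Suc n] = [j] @ [Suc j..<Suc n]" using assms(2) by (simp add: upt_conv_Cons)
    finally have "closed_walks t D 0 [Suc i..<Suc n] = closed_walks t D 0 (([Suc i..<j] @ [j]) @ [Suc j..<Suc n])"
      by simp
    also have "\<dots> = closed_walks t D 0 ([Suc i..<j] @ [j])"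
      using right(1) assms(3)
      by (intro closed_walks_final_ascents) (auto simp: atLeastSucLessThan_greaterThanLessThan atLeastLessThanSuc_atLeastAtMost atLeastSucAtMost_greaterThanAtMost simp del: upt_Suc)
    also have "\<dots> = extensions t D 0 [Suc i..<j]"
      using j assms(3) by (simp add: closed_walks_snoc)
    also have "\<dots> = order_maps t D [Suc i..<j]"
      using ij i by (simp add: upt_conv_Cons lessThan_atLeast0)
    finally show ?thesis using l by simp
  qed
qed

text \<open>Here \<open>i\<close> is the right end of the leftmost branch and \<open>j\<close> the bottom of the rightmost one; if they
  meet, then \<open>j \<le> i\<close> and the truncation is empty.\<close>

lemma elts_truncation:
  assumes D: "D \<subseteq> {1..n}"
  obtains i j where "i \<le> n" "j \<le> n" "{1..i} \<subseteq> D" "i = n \<or> Suc i \<notin> D"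
    "{j<..n} \<inter> D = {}" "j = 0 \<or> j \<in> D"
    "elts (truncation \<lparr>elts = {0..<Suc n}, desc = D\<rparr>) = {Suc i..<j}"
proof -
  define i where "i = (GREATEST i. i \<le> n \<and> {1..i} \<subseteq> D)"
  define j where "j = (LEAST j. j \<le> n \<and> {j<..n} \<inter> D = {})"
  have i: "i \<le> n" "{1..i} \<subseteq> D"
    using GreatestI_nat[of "\<lambda>i. i \<le> n \<and> {1..i} \<subseteq> D" 0 n] by (auto simp: i_def)
  have i_max: "l \<le> i" if "l \<le> n" "{1..l} \<subseteq> D" for l
    unfolding i_def using that by (intro Greatest_le_nat[where b = n]) auto
  have j: "j \<le> n" "{j<..n} \<inter> D = {}"
    using LeastI[of "\<lambda>j. j \<le> n \<and> {j<..n} \<inter> D = {}" n] by (auto simp: j_def)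
  have j_min: "j \<le> l" if "l \<le> n" "{l<..n} \<inter> D = {}" for l
    unfolding j_def using that by (intro Least_le) auto
  have "i = n \<or> Suc i \<notin> D"
  proof (rule ccontr)
    assume "\<not> ?thesis"
    then have "Suc i \<le> n" "{1..Suc i} \<subseteq> D" using i by (auto simp: le_Suc_eq)
    then show False using i_max[of "Suc i"] by simp
  qed
  moreover have "j = 0 \<or> j \<in> D"
  proof (rule ccontr)
    assume *: "\<not> ?thesis"
    then obtain j' where "j = Suc j'" by (cases j) auto
    then have "j' \<le> n" "{j'<..n} \<inter> D = {}" using * j by (auto simp: Suc_le_eq) (metis IntI Suc_lessI empty_iff greaterThanAtMost_iff)
    then show False using j_min[of j'] \<open>j = Suc j'\<close> by simp
  qed
  moreover have "elts (truncation \<lparr>elts = {0..<Suc n}, desc = D\<rparr>) = {Suc i..<j}"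
  proof -
    let ?P = "\<lparr>elts = {0..<Suc n}, desc = D\<rparr>"
    have "Min {0..<Suc n} = 0" by (intro Min_eqI) auto
    then have "left_branch ?P = {l. l \<le> n \<and> {1..l} \<subseteq> D}"
      unfolding left_branch_def by (simp only: fence.simps) (force simp: subset_eq less_Suc_eq_le)
    also have "\<dots> = {..i}" using i i_max by fastforce
    finally have L: "left_branch ?P = {..i}" .
    have "right_branch ?P = {l. l \<le> n \<and> {l<..n} \<inter> D = {}}"
      by (fastforce simp: right_branch_def asc_def)
    also have "\<dots> = {j..n}"
    proof (intro equalityI subsetI)
      fix l assume l: "l \<in> {j..n}"
      then have "{l<..n} \<subseteq> {j<..n}" by auto
      then show "l \<in> {l. l \<le> n \<and> {l<..n} \<inter> D = {}}" using l j(2) by auto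
    qed (use j_min in auto)
    finally have R: "right_branch ?P = {j..n}" .
    show ?thesis using j(1) by (auto simp: truncation_def Let_def L R)
  qed
  ultimately show thesis using that i j by blast
qed

section \<open>Lattice points as words, and their partial sums\<close>

text \<open>The coordinates of a lattice point in the dilate, with the sum shifted by a start value
  \<open>v\<close> that is the current partial sum modulo \<open>t\<close>.\<close>

definition words :: "nat \<Rightarrow> nat \<Rightarrow> nat \<Rightarrow> nat \<Rightarrow> nat list set" where
  "words t m v s = {xs. length xs = m \<and> set xs \<subseteq> {..t} \<and> v + sum_list xs = s}"

lemma finite_words: "finite (words t m v s)"
  unfolding words_def
  by (rule finite_subset[OF _ finite_lists_length_eq[of "{..t}" m]]) auto

lemma card_words_Suc: "card (words t (Suc m) v s) = (\<Sum>x\<le>t. card (words t m (v + x) s))"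
proof -
  have "words t (Suc m) v s = (\<Union>x\<le>t. (#) x ` words t m (v + x) s)"
    by (auto simp: words_def length_Suc_conv add.assoc image_iff)
  then have "card (words t (Suc m) v s) = (\<Sum>x\<le>t. card ((#) x ` words t m (v + x) s))"
    by (simp only:) (intro card_UN_disjoint; auto simp: finite_words)
  then show ?thesis by (simp add: card_image inj_on_def)
qed

text \<open>After the first letter \<open>x \<le> t\<close> the partial sum is \<open>v + x\<close>. If this is below \<open>t\<close>, the residue rises
  weakly; otherwise it is reduced by \<open>t\<close>, and since \<open>x \<le> t\<close>, the new residue is at most \<open>v\<close>. A letter
  \<open>0\<close> counts as a rise and a letter \<open>t\<close> as a fall, although both leave the residue unchanged.\<close>

lemma card_words_residue:
  assumes "v < t"
  shows "card (words t (Suc m) v (k * t)) =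
    (\<Sum>w\<in>{v..<t}. card (words t m w (k * t))) +
    (if k = 0 then 0 else \<Sum>w\<le>v. card (words t m w ((k - 1) * t)))"
proof -
  have "{..t} = {..<t - v} \<union> {t - v..t}" by auto
  then have "card (words t (Suc m) v (k * t)) =
      (\<Sum>x<t - v. card (words t m (v + x) (k * t))) + (\<Sum>x\<in>{t - v..t}. card (words t m (v + x) (k * t)))"
    unfolding card_words_Suc by (simp only:) (intro sum.union_disjoint; auto)
  moreover have "(\<Sum>x<t - v. card (words t m (v + x) (k * t))) = (\<Sum>w\<in>{v..<t}. card (words t m w (k * t)))"
    by (intro sum.reindex_bij_witness[where i = "\<lambda>w. w - v" and j = "\<lambda>x. v + x"]) auto
  moreover have "(\<Sum>x\<in>{t - v..t}. card (words t m (v + x) (k * t))) = (\<Sum>w\<le>v. card (words t m (t + w) (k * t)))"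
    using assms
    by (intro sum.reindex_bij_witness[where i = "\<lambda>w. t + w - v" and j = "\<lambda>x. v + x - t"]) auto
  moreover have "words t m (t + w) (k * t) = (if k = 0 then {} else words t m w ((k - 1) * t))" for w
    using assms by (cases k) (auto simp: words_def)
  ultimately show ?thesis by simp
qed

lemma sum_subsets_insert:
  fixes f :: "'a set \<Rightarrow> nat"
  assumes "finite A" "y \<notin> A"
  shows "(\<Sum>D | D \<subseteq> insert y A \<and> card D = k. f D) =
    (\<Sum>D | D \<subseteq> A \<and> card D = k. f D) +
    (if k = 0 then 0 else \<Sum>D | D \<subseteq> A \<and> card D = k - 1. f (insert y D))"
proof -
  have "{D. D \<subseteq> insert y A \<and> card D = k} =
      {D. D \<subseteq> A \<and> card D = k} \<union> {D. D \<subseteq> insert y A \<and> y \<in> D \<and> card D = k}" by auto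
  then have "(\<Sum>D | D \<subseteq> insert y A \<and> card D = k. f D) =
      (\<Sum>D | D \<subseteq> A \<and> card D = k. f D) + (\<Sum>D | D \<subseteq> insert y A \<and> y \<in> D \<and> card D = k. f D)"
    by (simp only:) (intro sum.union_disjoint; use assms in auto)
  moreover have "(\<Sum>D | D \<subseteq> insert y A \<and> y \<in> D \<and> card D = k. f D) =
      (if k = 0 then 0 else \<Sum>D | D \<subseteq> A \<and> card D = k - 1. f (insert y D))"
  proof (cases k)
    case 0
    have "card D \<noteq> 0" if "D \<subseteq> insert y A" "y \<in> D" for D
      using that assms(1) finite_subset[of D "insert y A"] by auto
    then have "{D. D \<subseteq> insert y A \<and> y \<in> D \<and> card D = k} = {}" using 0 by auto
    then show ?thesis using 0 by (simp only:) simp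
  next
    case (Suc k')
    have "(\<Sum>D | D \<subseteq> insert y A \<and> y \<in> D \<and> card D = k. f D) =
        (\<Sum>D | D \<subseteq> A \<and> card D = k - 1. f (insert y D))"
    proof (rule sum.reindex_bij_witness[where i = "insert y" and j = "\<lambda>D. D - {y}"])
      fix D assume "D \<in> {D. D \<subseteq> A \<and> card D = k - 1}"
      then show "insert y D \<in> {D. D \<subseteq> insert y A \<and> y \<in> D \<and> card D = k}"
        using assms Suc finite_subset[of D A] by (auto simp: card_insert_if)
    next
      fix D assume D: "D \<in> {D. D \<subseteq> insert y A \<and> y \<in> D \<and> card D = k}"
      then show "insert y (D - {y}) = D" by blast
      then show "f (insert y (D - {y})) = f D" by simp
      show "D - {y} \<in> {D. D \<subseteq> A \<and> card D = k - 1}"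
        using D by (auto simp: card_Diff_singleton)
    next
      fix D assume "D \<in> {D. D \<subseteq> A \<and> card D = k - 1}"
      then show "insert y D - {y} = D" using assms(2) by auto
    qed
    moreover have "k \<noteq> 0" using Suc by simp
    ultimately show ?thesis by (simp only: if_False)
  qed
  ultimately show ?thesis by (simp only:)
qed

text \<open>A word with sum \<open>k t\<close> is determined by the positions of its \<open>k\<close> reductions modulo \<open>t\<close> together with
  the residues of its partial sums; the residues rise weakly at ascents, fall weakly at descents, and
  end in \<open>0\<close>.\<close>

theorem sum_closed_walks:
  assumes "distinct ps" "v < t"
  shows "(\<Sum>D | D \<subseteq> set ps \<and> card D = k. closed_walks t D v ps) = card (words t (length ps) v (k * t))"
  using assms
proof (induction ps arbitrary: v k)
  case Nil
  have sets: "{D. D \<subseteq> set [] \<and> card D = k} = (if k = 0 then {{}} else {})" by auto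
  have words: "words t 0 v (k * t) = (if v = k * t then {[]} else {})" by (auto simp: words_def)
  show ?case
  proof (cases "k = 0")
    case False
    then have "t \<le> k * t" by simp
    then have "v \<noteq> k * t" using Nil.prems by linarith
    then show ?thesis using False by (simp only: sets words list.size if_False) simp
  next
    case True
    then show ?thesis unfolding sets words list.size by simp
  qed
next
  case (Cons y ps)
  have IH: "(\<Sum>D | D \<subseteq> set ps \<and> card D = k. \<Sum>w\<in>W. closed_walks t D w ps) =
      (\<Sum>w\<in>W. card (words t (length ps) w (k * t)))" if "W \<subseteq> {..<t}" for W k
  proof -
    have "(\<Sum>D | D \<subseteq> set ps \<and> card D = k. \<Sum>w\<in>W. closed_walks t D w ps) =
        (\<Sum>w\<in>W. \<Sum>D | D \<subseteq> set ps \<and> card D = k. closed_walks t D w ps)"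
      by (rule sum.swap)
    also have "\<dots> = (\<Sum>w\<in>W. card (words t (length ps) w (k * t)))"
    proof (rule sum.cong[OF refl])
      fix w assume "w \<in> W"
      then show "(\<Sum>D | D \<subseteq> set ps \<and> card D = k. closed_walks t D w ps) = card (words t (length ps) w (k * t))"
        using Cons.prems that by (intro Cons.IH) auto
    qed
    finally show ?thesis .
  qed
  have y: "y \<notin> set ps" using Cons.prems by simp
  have asc: "(\<Sum>D | D \<subseteq> set ps \<and> card D = k. closed_walks t D v (y # ps)) =
      (\<Sum>w\<in>{v..<t}. card (words t (length ps) w (k * t)))" for k
  proof -
    have "(\<Sum>D | D \<subseteq> set ps \<and> card D = k. closed_walks t D v (y # ps)) =
        (\<Sum>D | D \<subseteq> set ps \<and> card D = k. \<Sum>w\<in>{v..<t}. closed_walks t D w ps)"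
      using y by (intro sum.cong refl) auto
    also have "\<dots> = (\<Sum>w\<in>{v..<t}. card (words t (length ps) w (k * t)))"
      by (rule IH) auto
    finally show ?thesis .
  qed
  have desc: "(\<Sum>D | D \<subseteq> set ps \<and> card D = k. closed_walks t (insert y D) v (y # ps)) =
      (\<Sum>w\<le>v. card (words t (length ps) w (k * t)))" for k
  proof -
    have "closed_walks t (insert y D) w ps = closed_walks t D w ps" for D w
      using y by (intro closed_walks_cong) auto
    then have "(\<Sum>D | D \<subseteq> set ps \<and> card D = k. closed_walks t (insert y D) v (y # ps)) =
        (\<Sum>D | D \<subseteq> set ps \<and> card D = k. \<Sum>w\<le>v. closed_walks t D w ps)"
      by simp
    also have "\<dots> = (\<Sum>w\<le>v. card (words t (length ps) w (k * t)))"
      using Cons.prems by (intro IH) auto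
    finally show ?thesis .
  qed
  have "(\<Sum>D | D \<subseteq> set (y # ps) \<and> card D = k. closed_walks t D v (y # ps)) =
      (\<Sum>w\<in>{v..<t}. card (words t (length ps) w (k * t))) +
      (if k = 0 then 0 else \<Sum>w\<le>v. card (words t (length ps) w ((k - 1) * t)))"
    unfolding list.set sum_subsets_insert[OF finite_set y] asc desc ..
  also have "\<dots> = card (words t (length (y # ps)) v (k * t))"
    using card_words_residue[OF Cons.prems(2)] by simp
  finally show ?case .
qed

lemma card_lattice_points_hypersimplex:
  fixes t :: nat
  assumes "t > 0"
  shows "card (lattice_points ((\<lambda>x. real t *\<^sub>R x) ` (hypersimplex k :: (real ^ 'n) set))) =
    card (words t CARD('n::finite) 0 (k * t))"
proof -
  let ?n = "CARD('n)"
  let ?L = "lattice_points ((\<lambda>x. real t *\<^sub>R x) ` (hypersimplex k :: (real ^ 'n) set))"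
  obtain e :: "nat \<Rightarrow> 'n" where e: "bij_betw e {0..<?n} UNIV"
    using ex_bij_betw_nat_finite[of "UNIV :: 'n set"] by auto
  define ix where "ix = inv_into {0..<?n} e"
  have ix: "ix i < ?n" "e (ix i) = i" for i
    using e bij_betw_inv_into_right[OF e, of i] bij_betw_inv_into[OF e]
    by (auto simp: ix_def bij_betw_def)
  have ix_e: "ix (e j) = j" if "j < ?n" for j
    using bij_betw_inv_into_left[OF e, of j] that by (simp add: ix_def)
  have L: "?L = {x. (\<forall>i. x $ i \<in> \<int> \<and> 0 \<le> x $ i \<and> x $ i \<le> real t) \<and> (\<Sum>i\<in>UNIV. x $ i) = real (k * t)}"
  proof (intro set_eqI iffI)
    fix x assume "x \<in> ?L"
    then show "x \<in> {x. (\<forall>i. x $ i \<in> \<int> \<and> 0 \<le> x $ i \<and> x $ i \<le> real t) \<and> (\<Sum>i\<in>UNIV. x $ i) = real (k * t)}"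
      by (auto simp: lattice_points_def hypersimplex_def mult_left_le simp flip: sum_distrib_left)
  next
    fix x :: "real ^ 'n"
    assume x: "x \<in> {x. (\<forall>i. x $ i \<in> \<int> \<and> 0 \<le> x $ i \<and> x $ i \<le> real t) \<and> (\<Sum>i\<in>UNIV. x $ i) = real (k * t)}"
    let ?y = "(1 / real t) *\<^sub>R x"
    have "x = real t *\<^sub>R ?y" using assms by simp
    moreover have "?y \<in> hypersimplex k"
      using x assms by (auto simp: hypersimplex_def simp flip: sum_divide_distrib)
    ultimately have "x \<in> (\<lambda>x. real t *\<^sub>R x) ` hypersimplex k" by (rule image_eqI)
    then show "x \<in> ?L" using x by (auto simp: lattice_points_def)
  qed
  have "bij_betw (\<lambda>xs. \<chi> i. real (xs ! ix i)) (words t ?n 0 (k * t)) ?L"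
  proof (rule bij_betw_byWitness[where f' = "\<lambda>x. map (\<lambda>j. nat \<lfloor>x $ e j\<rfloor>) [0..<?n]"])
    show "\<forall>xs\<in>words t ?n 0 (k * t). map (\<lambda>j. nat \<lfloor>(\<chi> i. real (xs ! ix i)) $ e j\<rfloor>) [0..<?n] = xs"
      by (auto simp: words_def ix_e intro!: nth_equalityI)
    have floor: "real (nat \<lfloor>x $ i\<rfloor>) = x $ i" if "x \<in> ?L" for x i
      using that by (auto simp: L elim!: Ints_cases)
    show "\<forall>x\<in>?L. (\<chi> i. real (map (\<lambda>j. nat \<lfloor>x $ e j\<rfloor>) [0..<?n] ! ix i)) = x"
      using floor by (auto simp: ix vec_eq_iff)
    have sum_eq: "(\<Sum>i\<in>UNIV. f i) = (\<Sum>j<?n. f (e j))" for f :: "'n \<Rightarrow> real"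
      using sum.reindex_bij_betw[OF e, of f] by (simp add: lessThan_atLeast0)
    show "(\<lambda>xs. \<chi> i. real (xs ! ix i)) ` words t ?n 0 (k * t) \<subseteq> ?L"
    proof (intro image_subsetI)
      fix xs assume xs: "xs \<in> words t ?n 0 (k * t)"
      then have "xs ! ix i \<le> t" for i using nth_mem[of "ix i" xs] ix(1)[of i] unfolding words_def by fastforce
      moreover have "(\<Sum>i\<in>UNIV. real (xs ! ix i)) = real (sum_list xs)"
        using xs by (simp add: sum_eq ix_e words_def sum_list_sum_nth lessThan_atLeast0)
      ultimately show "(\<chi> i. real (xs ! ix i)) \<in> ?L" using xs by (simp add: L words_def)
    qed
    show "(\<lambda>x. map (\<lambda>j. nat \<lfloor>x $ e j\<rfloor>) [0..<?n]) ` ?L \<subseteq> words t ?n 0 (k * t)"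
    proof (intro image_subsetI)
      fix x assume x: "x \<in> ?L"
      let ?xs = "map (\<lambda>j. nat \<lfloor>x $ e j\<rfloor>) [0..<?n]"
      have "real (sum_list ?xs) = (\<Sum>j<?n. x $ e j)"
        using floor[OF x] by (auto simp: sum_list_sum_nth lessThan_atLeast0 intro!: sum.cong)
      also have "\<dots> = real (k * t)" using x by (simp add: L flip: sum_eq)
      finally have "sum_list ?xs = k * t" by (simp only: of_nat_eq_iff)
      moreover have "nat \<lfloor>x $ e j\<rfloor> \<le> t" for j
      proof -
        have "real (nat \<lfloor>x $ e j\<rfloor>) \<le> real t" using x floor[OF x] by (simp add: L)
        then show ?thesis by simp
      qed
      ultimately show "?xs \<in> words t ?n 0 (k * t)" by (auto simp: words_def)
    qed
  qed
  then show ?thesis by (simp add: bij_betw_same_card)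
qed

section \<open>The Ehrhart polynomial of the hypersimplex\<close>

lemma labelings_eq_bijections: "labelings P = bijections (elts P) {1..int (card (elts P))}"
  by (simp add: labelings_def bijections_def)

text \<open>The labels of the removed elements do not matter, so the sum over all labelings of \<open>P\<close> is
  \<open>(n + 1)!\<close> times the order polynomial of the truncated fence.\<close>

lemma sum_power_TrBl:
  assumes P: "P = \<lparr>elts = {0..<Suc n}, desc = D\<rparr>" and D: "D \<subseteq> {1..n}" and t: "t > 0"
  shows "(\<Sum>\<sigma>\<in>labelings P. real t ^ TrBl P \<sigma>) =
    fact (Suc n) * real (closed_walks t D 0 [1..<Suc n])"
proof -
  obtain i j where ij: "i \<le> n" "j \<le> n" "{1..i} \<subseteq> D" "i = n \<or> Suc i \<notin> D"
    "{j<..n} \<inter> D = {}" "j = 0 \<or> j \<in> D" and elts: "elts (truncation P) = {Suc i..<j}"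
    using elts_truncation[OF D] unfolding P by metis
  let ?A = "{Suc i..<j}"
  let ?U = "{1..int (Suc n)}"
  let ?F = "\<lambda>\<sigma>. real t ^ roots D \<sigma> [Suc i..<j]"
  have desc: "desc (truncation P) = D \<inter> ?A"
    using elts by (simp add: truncation_def Let_def P)
  have A: "{0..<Suc n} = ?A \<union> ({0..<Suc n} - ?A)" using ij(2) by auto
  have "TrBl P \<sigma> = roots D (restrict \<sigma> ?A) [Suc i..<j]" if "\<sigma> \<in> bijections {0..<Suc n} ?U" for \<sigma>
  proof -
    have "inj_on \<sigma> {0..<Suc n}" using that by (auto simp: bijections_def bij_betw_def)
    then have "inj_on (restrict \<sigma> ?A) ?A" using ij(2) by (auto simp: inj_on_def)
    then have "TrBl P \<sigma> = roots (D \<inter> ?A) (restrict \<sigma> ?A) [Suc i..<j]"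
      using bl_eq_roots[OF elts] by (simp add: TrBl_def elts desc)
    also have "\<dots> = roots D (restrict \<sigma> ?A) [Suc i..<j]"
      by (intro roots_cong) (auto dest: list.set_sel(2)[rotated])
    finally show ?thesis .
  qed
  then have "(\<Sum>\<sigma>\<in>labelings P. real t ^ TrBl P \<sigma>) =
      (\<Sum>\<sigma>\<in>bijections (?A \<union> ({0..<Suc n} - ?A)) ?U. ?F (restrict \<sigma> ?A) * 1)"
    unfolding A[symmetric] by (simp add: labelings_eq_bijections P)
  also have "\<dots> = fact (card ?U) * (real (order_maps t D [Suc i..<j]) * 1)"
  proof (rule sum_bijections_independent)
    show "card ?U = card ?A + card ({0..<Suc n} - ?A)"
      using ij(2) by (subst card_Diff_subset) auto
    fix V assume V: "V \<subseteq> ?U"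
    then have "finite V" by (rule finite_subset) simp
    show "sum ?F (bijections ?A V) = fact (card ?A) * real (order_maps t D [Suc i..<j])" if "card V = card ?A"
      using sum_power_roots[of "[Suc i..<j]" V t D] that t \<open>finite V\<close> by simp
    show "(\<Sum>\<sigma>\<in>bijections ({0..<Suc n} - ?A) V. 1) = fact (card ({0..<Suc n} - ?A)) * (1::real)"
      if "card V = card ({0..<Suc n} - ?A)"
      using that \<open>finite V\<close> by (simp add: card_bijections)
  qed auto
  also have "order_maps t D [Suc i..<j] = closed_walks t D 0 [1..<Suc n]"
    using closed_walks_eq_order_maps[of i n j t D] ij t by simp
  also have "card ?U = Suc n" by simp
  finally show ?thesis by (simp only: mult_1_right)
qed

theorem proposition6p8:
  fixes n k :: nat
  assumes "CARD('n::finite) = n" and "k \<le> n"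
  shows "is_ehrhart_polynomial (hypersimplex k :: (real ^ 'n) set)
           (smult (1 / fact (n + 1))
             (\<Sum>P | P \<in> fence_posets (n + 1) \<and> card (desc P) = k.
                \<Sum>\<sigma>\<in>labelings P. monom 1 (TrBl P \<sigma>)))"
  unfolding is_ehrhart_polynomial_def
proof (intro allI impI)
  fix t :: nat
  assume t: "t > 0"
  let ?\<D> = "{D. D \<subseteq> {1..n} \<and> card D = k}"
  have "(\<Sum>P | P \<in> fence_posets (n + 1) \<and> card (desc P) = k. \<Sum>\<sigma>\<in>labelings P. real t ^ TrBl P \<sigma>) =
      (\<Sum>D\<in>?\<D>. fact (Suc n) * real (closed_walks t D 0 [1..<Suc n]))"
  proof (rule sum.reindex_bij_witness[where i = "\<lambda>D. \<lparr>elts = {0..<Suc n}, desc = D\<rparr>" and j = desc])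
    fix P :: fence assume "P \<in> {P \<in> fence_posets (n + 1). card (desc P) = k}"
    then have P: "P = \<lparr>elts = {0..<Suc n}, desc = desc P\<rparr>" "desc P \<subseteq> {1..n}"
      by (auto simp: fence_posets_def intro!: fence.equality)
    then show "\<lparr>elts = {0..<Suc n}, desc = desc P\<rparr> = P" by simp
    show "fact (Suc n) * real (closed_walks t (desc P) 0 [1..<Suc n]) = (\<Sum>\<sigma>\<in>labelings P. real t ^ TrBl P \<sigma>)"
      using sum_power_TrBl[OF P t] by simp
  qed (auto simp: fence_posets_def)
  also have "\<dots> = fact (Suc n) * real (\<Sum>D\<in>?\<D>. closed_walks t D 0 [1..<Suc n])"
    by (simp only: sum_distrib_left of_nat_sum)
  also have "(\<Sum>D\<in>?\<D>. closed_walks t D 0 [1..<Suc n]) = card (words t n 0 (k * t))"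
    using sum_closed_walks[of "[1..<Suc n]" 0 t k] t
    by (simp add: atLeastLessThanSuc_atLeastAtMost del: upt_Suc)
  also have "\<dots> = card (lattice_points ((\<lambda>x. real t *\<^sub>R x) ` (hypersimplex k :: (real ^ 'n) set)))"
    using card_lattice_points_hypersimplex[OF t, where 'n = 'n and k = k] assms(1) by simp
  finally show "poly (smult (1 / fact (n + 1))
      (\<Sum>P | P \<in> fence_posets (n + 1) \<and> card (desc P) = k. \<Sum>\<sigma>\<in>labelings P. monom 1 (TrBl P \<sigma>))) (real t) =
    real (card (lattice_points ((\<lambda>x. real t *\<^sub>R x) ` (hypersimplex k :: (real ^ 'n) set))))"
    by (simp add: poly_sum poly_monom)
qed

end
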